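(* Let $m\geq 2$ and $1\leq i\leq m-1$. Then $$\frac{d_i(m)^2}{d_{i-1}(m)d_{i+1}(m)}>\frac{(m-i+1)(i+1)(m+i)}{(m-i)\,i\,(m+i+1)}.$$
   Context: For integers $m\geq 0$, the Boros-Moll polynomial is $P_m(a)=2^{-2m}\sum_{k}2^k\binom{2m-2k}{m-k}\binom{m+k}{k}(a+1)^k=\sum_{i=0}^m d_i(m)a^i$, so that $d_i(m)=2^{-2m}\sum_{k=0}^m 2^k\binom{2m-2k}{m-k}\binom{m+k}{m}\binom{k}{i}$ for $0\le i\le m$. These coefficients are positive. *)

theory Defs
  imports Complex_Main "HOL-Computational_Algebra.Polynomial"
begin

definition boros_moll :: "nat \<Rightarrow> real poly" where
  "boros_moll m = smult (1 / 2 ^ (2 * m))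
     (\<Sum>k\<le>m. smult (2 ^ k * real ((2 * m - 2 * k) choose (m - k)) * real ((m + k) choose k))
        ([:1, 1:] ^ k))"

definition boros_moll_coeff :: "nat \<Rightarrow> nat \<Rightarrow> real" where
  "boros_moll_coeff i m = coeff (boros_moll m) i"

lemma coeff_linear_1_power: "coeff ([:1, 1:] ^ k :: real poly) i = real (k choose i)"
  by (cases "i \<le> k") (simp_all add: coeff_linear_poly_power binomial_eq_0 coeff_eq_0 degree_linear_power)

lemma boros_moll_coeff_eq:
  "boros_moll_coeff i m = 1 / 2 ^ (2 * m) *
     (\<Sum>k\<le>m. 2 ^ k * real ((2 * m - 2 * k) choose (m - k)) * real ((m + k) choose m) * real (k choose i))"
proof -
  have "(m + k) choose k = (m + k) choose m" for k
    using binomial_symmetric[of k "m + k"] by simp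
  then show ?thesis
    by (simp add: boros_moll_coeff_def boros_moll_def coeff_sum coeff_linear_1_power)
qed

lemma boros_moll_eq_sum:
  "poly (boros_moll m) a = (\<Sum>i\<le>m. boros_moll_coeff i m * a ^ i)"
proof -
  have "degree (boros_moll m) \<le> m"
  proof (rule degree_le, intro allI impI)
    fix i assume "m < i"
    then have "boros_moll_coeff i m = 0"
      unfolding boros_moll_coeff_eq by (simp add: binomial_eq_0)
    then show "coeff (boros_moll m) i = 0"
      by (simp add: boros_moll_coeff_def)
  qed
  then show ?thesis
    unfolding poly_altdef boros_moll_coeff_def
    by (intro sum.mono_neutral_left) (auto simp: coeff_eq_0)
qed

lemma boros_moll_coeff_pos:
  assumes "i \<le> m"
  shows "boros_moll_coeff i m > 0"
proof -
  have "0 < (\<Sum>k\<le>m. 2 ^ k * real ((2 * m - 2 * k) choose (m - k)) * real ((m + k) choose m) * real (k choose i))"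
    by (rule sum_pos2[of _ m]) (use assms in auto)
  then show ?thesis
    by (simp add: boros_moll_coeff_eq)
qed

end

theory Submission
  imports Defs
begin

text \<open>
  Write \<open>d\<^sub>i\<close> for \<open>d\<^sub>i(m)\<close>. The hypergeometric differential equation of the
  Boros-Moll polynomial gives
  \<open>i (i+1) d\<^sub>i\<^sub>+\<^sub>1 = i (2m+1) d\<^sub>i - (m-i+1) (m+i) d\<^sub>i\<^sub>-\<^sub>1\<close>. Eliminating \<open>d\<^sub>i\<^sub>+\<^sub>1\<close> turns
  the claim into a quadratic inequality in \<open>y = (m-i+1) (m+i) d\<^sub>i\<^sub>-\<^sub>1 / d\<^sub>i\<close> whose
  discriminant is the square \<open>i\<^sup>2 (2i+1)\<^sup>2\<close>; its roots are \<open>i (m-i)\<close> and \<open>i (m+i+1)\<close>.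
  The recurrence yields \<open>y > i (m+i+1)\<close> for \<open>i < m\<close> by descending induction from
  \<open>i = m\<close>, where equality holds.
\<close>

definition boros_moll_weight :: "nat \<Rightarrow> nat \<Rightarrow> real" where
  "boros_moll_weight m k =
     2 ^ k * real ((2 * m - 2 * k) choose (m - k)) * real ((m + k) choose m)"

lemma boros_moll_coeff_eq_weight:
  "boros_moll_coeff i m = (\<Sum>k\<le>m. boros_moll_weight m k * real (k choose i)) / 2 ^ (2 * m)"
  by (simp add: boros_moll_coeff_eq boros_moll_weight_def)

lemma central_binomial_Suc:
  "Suc n * ((2 * Suc n) choose Suc n) = 2 * (2 * n + 1) * ((2 * n) choose n)"
proof -
  have "Suc n * ((2 * n + 1) choose n) = (2 * n + 1) * ((2 * n) choose n)"
    using binomial_absorb_comp[of "2 * n + 1" n] by simp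
  moreover have "Suc n * ((2 * Suc n) choose Suc n) = 2 * Suc n * ((2 * n + 1) choose n)"
    using Suc_times_binomial_eq[of "2 * n + 1" n] by (simp add: mult.commute)
  ultimately show ?thesis
    by (metis mult.assoc)
qed

text \<open>The weight is a hypergeometric term in \<open>k\<close>: with
  \<open>n = m - k - 1\<close>, passing from \<open>k\<close> to \<open>k + 1\<close> lowers the
  central binomial from index \<open>n + 1\<close> to \<open>n\<close>, and absorption governs the
  other binomial.\<close>

lemma boros_moll_weight_Suc:
  assumes "k < m"
  shows "(real k + 1) * (2 * real m - 2 * real k - 1) * boros_moll_weight m (Suc k)
    = (real m - real k) * (real m + real k + 1) * boros_moll_weight m k"
proof -
  obtain n where m: "m = Suc (k + n)"
    using assms less_iff_Suc_add by auto
  define B where "B = real ((2 * n) choose n)"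
  define B' where "B' = real ((2 * Suc n) choose Suc n)"
  define C where "C = real ((m + k) choose m)"
  define C' where "C' = real ((m + Suc k) choose m)"
  have B: "(real n + 1) * B' = 2 * (2 * real n + 1) * B"
    using arg_cong[OF central_binomial_Suc[of n], of real]
    unfolding B_def B'_def of_nat_mult by (simp add: algebra_simps)
  have "Suc k * ((m + Suc k) choose m) = (m + Suc k) * ((m + k) choose m)"
    using binomial_absorb_comp[of "m + Suc k" m] by simp
  then have C: "(real k + 1) * C' = (real m + real k + 1) * C"
    unfolding C_def C'_def
    by (metis (no_types, lifting) add.assoc add.commute of_nat_Suc of_nat_add of_nat_mult)
  have w: "boros_moll_weight m k = 2 ^ k * B' * C"
    "boros_moll_weight m (Suc k) = 2 * 2 ^ k * B * C'"
    using m by (simp_all add: boros_moll_weight_def B_def B'_def C_def C'_def algebra_simps)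
  have "(real k + 1) * (2 * real m - 2 * real k - 1) * boros_moll_weight m (Suc k)
      = 2 ^ k * (2 * (2 * real n + 1) * B) * ((real k + 1) * C')"
    unfolding w by (simp add: m)
  also have "\<dots> = 2 ^ k * ((real n + 1) * B') * ((real m + real k + 1) * C)"
    by (simp only: B C)
  also have "\<dots> = (real m - real k) * (real m + real k + 1) * boros_moll_weight m k"
    unfolding w by (simp add: m)
  finally show ?thesis .
qed

lemma Suc_times_binomial_Suc_real:
  "(real j + 1) * real (k choose Suc j) = (real k - real j) * real (k choose j)"
proof (cases "j \<le> k")
  case True
  have "Suc j * (k choose Suc j) = (k - j) * (k choose j)"
    by (metis binomial_absorb_comp binomial_absorption)
  then have "real (Suc j * (k choose Suc j)) = real ((k - j) * (k choose j))"
    by simp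
  with True show ?thesis
    by (simp add: of_nat_diff algebra_simps)
qed (simp add: binomial_eq_0)

text \<open>Creative telescoping: the same combination of the \<open>k\<close>-th summands equals
  \<open>F (Suc k) - F k\<close>, and \<open>F\<close> vanishes at both ends of the range.\<close>

lemma boros_moll_coeff_recurrence:
  "(real j + 1) * (real j + 2) * boros_moll_coeff (j + 2) m
    = (real j + 1) * (2 * real m + 1) * boros_moll_coeff (j + 1) m
      - (real m - real j) * (real m + real j + 1) * boros_moll_coeff j m"
proof -
  define w where "w = boros_moll_weight m"
  \<comment> \<open>Stating the certificate through the weight at \<open>k - 1\<close> makes
    \<open>F (Suc m) = 0\<close> visible from the factor \<open>real m - real l\<close> at
    \<open>l = m\<close>.\<close>
  define F where "F k = (case k of 0 \<Rightarrow> 0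
    | Suc l \<Rightarrow> (real m - real l) * (real m + real l + 1) * w l * real (l choose j))" for k
  \<comment> \<open>The weight recursion rewrites \<open>F k\<close> in terms of \<open>w k\<close>,
    so that \<open>F (Suc k) - F k\<close> has the common factor
    \<open>w k * real (k choose j)\<close>.\<close>
  have F: "F k = (2 * real m + 1 - 2 * real k) * w k * ((real k - real j) * real (k choose j))"
    if "k \<le> m" for k
  proof (cases k)
    case 0
    then show ?thesis by (cases j) (simp_all add: F_def)
  next
    case (Suc l)
    have b: "(real k - real j) * real (k choose j) = real k * real (l choose j)"
      using Suc_times_binomial_Suc_real[of j k] arg_cong[OF Suc_times_binomial_eq[of l j], of real] Suc
      by (simp add: algebra_simps)
    have "F k = (real l + 1) * (2 * real m - 2 * real l - 1) * w k * real (l choose j)"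
      using boros_moll_weight_Suc[of l m] that Suc by (simp add: F_def w_def)
    then show ?thesis
      unfolding b using Suc by (simp add: algebra_simps)
  qed
  have summand: "w k * ((real j + 1) * (real j + 2) * real (k choose (j + 2))
      - (real j + 1) * (2 * real m + 1) * real (k choose (j + 1))
      + (real m - real j) * (real m + real j + 1) * real (k choose j)) = F (Suc k) - F k"
    if "k \<le> m" for k
  proof -
    define x where "x = real (k choose j)"
    have b1: "(real j + 1) * real (k choose (j + 1)) = (real k - real j) * x"
      using Suc_times_binomial_Suc_real[of j k] by (simp add: x_def)
    have "(real j + 2) * real (k choose (j + 2)) = (real k - real j - 1) * real (k choose (j + 1))"
      using Suc_times_binomial_Suc_real[of "Suc j" k] by (simp add: algebra_simps)
    then have b2: "(real j + 1) * (real j + 2) * real (k choose (j + 2))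
        = (real k - real j - 1) * ((real k - real j) * x)"
      unfolding b1[symmetric] by (simp add: mult.assoc mult.left_commute)
    have b1': "(real j + 1) * (2 * real m + 1) * real (k choose (j + 1))
        = (2 * real m + 1) * ((real k - real j) * x)"
      unfolding b1[symmetric] by (simp add: mult.assoc mult.left_commute)
    have F': "F (Suc k) = (real m - real k) * (real m + real k + 1) * w k * x"
      by (simp add: F_def x_def)
    show ?thesis
      unfolding b2 b1' F' F[OF that] x_def[symmetric] by algebra
  qed
  have "(\<Sum>k\<le>m. F (Suc k) - F k) = F (Suc m) - F 0"
    using sum_lessThan_telescope[of F "Suc m"] by (simp add: lessThan_Suc_atMost)
  then have "(\<Sum>k\<le>m. F (Suc k) - F k) = 0"
    by (simp add: F_def)
  then have "(\<Sum>k\<le>m. w k * ((real j + 1) * (real j + 2) * real (k choose (j + 2))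
      - (real j + 1) * (2 * real m + 1) * real (k choose (j + 1))
      + (real m - real j) * (real m + real j + 1) * real (k choose j))) = 0"
    using summand by (metis (no_types, lifting) atMost_iff sum.cong)
  then have "(real j + 1) * (real j + 2) * (\<Sum>k\<le>m. w k * real (k choose (j + 2)))
      - (real j + 1) * (2 * real m + 1) * (\<Sum>k\<le>m. w k * real (k choose (j + 1)))
      + (real m - real j) * (real m + real j + 1) * (\<Sum>k\<le>m. w k * real (k choose j)) = 0"
    by (simp only: sum_distrib_left ring_distribs sum.distrib sum_subtractf mult_ac)
  then show ?thesis
    unfolding boros_moll_coeff_eq_weight w_def[symmetric]
      times_divide_eq_right diff_divide_distrib[symmetric]
    by (intro arg_cong2[of _ _ _ _ "(/)"] refl) linarith
qed

lemma boros_moll_coeff_gt_degree: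
  "m < i \<Longrightarrow> boros_moll_coeff i m = 0"
  by (simp add: boros_moll_coeff_eq binomial_eq_0)

text \<open>One step of the descent. A non-strict bound at \<open>j + 1\<close> suffices for a
  strict one at \<open>j\<close>, because cancelling \<open>m + j + 2\<close> against
  \<open>m + j + 3\<close> leaves slack.\<close>

lemma boros_moll_coeff_ratio_step:
  assumes "j + 1 < m"
    and "(real m - real j - 1) * (real m + real j + 2) * boros_moll_coeff (j + 1) m
      \<ge> (real j + 2) * (real m + real j + 3) * boros_moll_coeff (j + 2) m"
  shows "(real m - real j) * (real m + real j + 1) * boros_moll_coeff j m
    > (real j + 1) * (real m + real j + 2) * boros_moll_coeff (j + 1) m"
proof -
  define p q where "p = boros_moll_coeff (j + 1) m" and "q = boros_moll_coeff (j + 2) m"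
  have pos: "p > 0" "q > 0"
    using assms(1) by (auto simp: p_def q_def intro!: boros_moll_coeff_pos)
  have "(real m + real j + 2) * ((real j + 2) * q) < (real j + 2) * (real m + real j + 3) * q"
    using pos by (simp add: algebra_simps add_nonneg_pos)
  also have "\<dots> \<le> (real m + real j + 2) * ((real m - real j - 1) * p)"
    using assms(2) by (simp add: p_def q_def mult_ac)
  finally have "(real j + 2) * q < (real m - real j - 1) * p"
    by (simp add: add_nonneg_pos)
  then have "(real j + 1) * ((real j + 2) * q) < (real j + 1) * ((real m - real j - 1) * p)"
    by simp
  \<comment> \<open>Bounding the \<open>d\<^sub>j\<^sub>+\<^sub>2\<close> term of the recurrence
    leaves the factor \<open>(2m + 1) - (m - j - 1) = m + j + 2\<close>.\<close>
  then show ?thesis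
    using boros_moll_coeff_recurrence[of j m]
    unfolding p_def[symmetric] q_def[symmetric] by (simp add: algebra_simps)
qed

lemma boros_moll_coeff_ratio_ge:
  assumes "j < m"
  shows "(real m - real j) * (real m + real j + 1) * boros_moll_coeff j m
    \<ge> (real j + 1) * (real m + real j + 2) * boros_moll_coeff (j + 1) m"
  using assms
proof (induction "m - j" arbitrary: j)
  case (Suc n)
  show ?case
  proof (cases "j + 1 = m")
    case True
    \<comment> \<open>Start of the descent: without its leading term the recurrence gives equality
      at \<open>j = m - 1\<close>, hence the non-strict form of the lemma.\<close>
    then have "boros_moll_coeff (j + 2) m = 0"
      by (simp add: boros_moll_coeff_gt_degree)
    with True show ?thesis
      using boros_moll_coeff_recurrence[of j m] by (auto simp: algebra_simps)
  next
    case False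
    with Suc.prems have "j + 1 < m" by simp
    moreover have "(real m - real (j + 1)) * (real m + real (j + 1) + 1) * boros_moll_coeff (j + 1) m
      \<ge> (real (j + 1) + 1) * (real m + real (j + 1) + 2) * boros_moll_coeff (j + 1 + 1) m"
      using Suc.hyps(1)[of "j + 1"] Suc.hyps(2) \<open>j + 1 < m\<close> by simp
    ultimately show ?thesis
      by (intro less_imp_le[OF boros_moll_coeff_ratio_step]) (simp_all add: algebra_simps)
  qed
qed simp

lemma boros_moll_coeff_ratio_gt:
  assumes "j + 1 < m"
  shows "(real m - real j) * (real m + real j + 1) * boros_moll_coeff j m
    > (real j + 1) * (real m + real j + 2) * boros_moll_coeff (j + 1) m"
  using assms boros_moll_coeff_ratio_ge[of "j + 1" m]
  by (intro boros_moll_coeff_ratio_step) (simp_all add: algebra_simps)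

theorem theorem1p2:
  fixes m i :: nat
  assumes "m \<ge> 2" and "1 \<le> i" and "i \<le> m - 1"
  shows "(boros_moll_coeff i m)\<^sup>2 / (boros_moll_coeff (i - 1) m * boros_moll_coeff (i + 1) m)
    > ((real m - real i + 1) * (real i + 1) * (real m + real i))
        / ((real m - real i) * real i * (real m + real i + 1))"
proof -
  obtain j where i: "i = j + 1"
    using assms(2) by (metis add.commute le_Suc_ex)
  have jm: "j + 1 < m"
    using assms i by simp
  define a b c where "a = boros_moll_coeff j m" and "b = boros_moll_coeff (j + 1) m"
    and "c = boros_moll_coeff (j + 2) m"
  have pos: "a > 0" "b > 0" "c > 0"
    using jm by (auto simp: a_def b_def c_def intro!: boros_moll_coeff_pos)
  define M I where "M = real m" and "I = real i"
  have MI: "I \<ge> 1" "M > I"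
    using jm by (auto simp: M_def I_def i)
  \<comment> \<open>This is the quotient of the overview multiplied by \<open>b\<close>, so the
    roots become \<open>I * (M - I) * b\<close> and \<open>I * (M + I + 1) * b\<close>.\<close>
  define y where "y = (M - I + 1) * (M + I) * a"
  have rec: "I * (I + 1) * c = I * (2 * M + 1) * b - y"
    using boros_moll_coeff_recurrence[of j m]
    by (simp add: a_def b_def c_def M_def I_def y_def i algebra_simps)
  have gt: "y > I * (M + I + 1) * b"
    using boros_moll_coeff_ratio_gt[OF jm]
    by (simp add: a_def b_def M_def I_def y_def i algebra_simps)
  \<comment> \<open>Exceeding the larger root, \<open>y\<close> exceeds both, so the quadratic is
    positive.\<close>
  have "I * (M - I) * b \<le> I * (M + I + 1) * b"
    using MI pos by (intro mult_right_mono mult_left_mono) auto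
  with gt have "0 < (y - I * (M + I + 1) * b) * (y - I * (M - I) * b)"
    by (intro mult_pos_pos) simp_all
  also have "\<dots> = I * (I * (M - I) * (M + I + 1) * b\<^sup>2) - y * (I * (2 * M + 1) * b - y)"
    by algebra
  \<comment> \<open>Reading \<open>rec\<close> backwards brings \<open>c\<close> back in and exposes
    a common positive factor \<open>I\<close>.\<close>
  also have "\<dots> = I * ((M - I) * I * (M + I + 1) * b\<^sup>2 - (M - I + 1) * (I + 1) * (M + I) * (a * c))"
    unfolding rec[symmetric] unfolding y_def by algebra
  finally have "(M - I + 1) * (I + 1) * (M + I) * (a * c) < (M - I) * I * (M + I + 1) * b\<^sup>2"
    using MI by (simp add: zero_less_mult_iff)
  then have "(M - I + 1) * (I + 1) * (M + I) / ((M - I) * I * (M + I + 1)) < b\<^sup>2 / (a * c)"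
    using MI pos by (simp add: divide_less_eq less_divide_eq mult_ac)
  then show ?thesis
    by (simp add: a_def b_def c_def M_def I_def i)
qed

end
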